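(* Let $k\ge 1$ and let $G$ be a graph with minimum degree at least $k$. Let $a$ be a number with $\delta(G)\ge a+k$. If $\gamma_{\times k,t}(G)\le a$, then $\gamma_{\times k,t}^{r}(G)\le a$.
   Context: All graphs are finite and simple; $N(x)$ denotes the open neighborhood of $x$ and $\delta(G)$ the minimum degree. For an integer $k\ge 1$, a set $S\subseteq V(G)$ is a $k$-tuple total dominating set (kTDS) of $G$ if $|N(x)\cap S|\ge k$ for every $x\in V(G)$; $\gamma_{\times k,t}(G)$ is the minimum cardinality of a kTDS. A kTDS $S$ is a $k$-tuple total restrained dominating set (kTRDS) if moreover every vertex $x\in V(G)\setminus S$ is adjacent to at least $k$ vertices of $V(G)\setminus S$; $\gamma_{\times k,t}^{r}(G)$ is the minimum cardinality of a kTRDS. *)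

theory Defs
  imports Complex_Main "Graph_Theory.Digraph"
begin

text \<open>
  A finite simple graph is a structure satisfying \<^locale>\<open>graph\<close>: a finite symmetric
  digraph without loops and parallel arcs, where an edge is a pair of opposite arcs.
\<close>

definition neighborhood :: "('a, 'b) pre_digraph \<Rightarrow> 'a \<Rightarrow> 'a set" where
  "neighborhood G x = {y. x \<rightarrow>\<^bsub>G\<^esub> y}"

text \<open>
  The locale admits the null graph. Since the infimum of the empty set of natural numbers
  is 0, the null graph gets minimum degree 0, so it never satisfies a lower bound
  \<open>k \<ge> 1\<close> on the minimum degree.
\<close>

definition min_degree :: "('a, 'b) pre_digraph \<Rightarrow> nat" where
  "min_degree G = (INF x\<in>verts G. card (neighborhood G x))"

definition kTDS :: "('a, 'b) pre_digraph \<Rightarrow> nat \<Rightarrow> 'a set \<Rightarrow> bool" where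
  "kTDS G k S \<longleftrightarrow> S \<subseteq> verts G \<and> (\<forall>x\<in>verts G. k \<le> card (neighborhood G x \<inter> S))"

definition kTRDS :: "('a, 'b) pre_digraph \<Rightarrow> nat \<Rightarrow> 'a set \<Rightarrow> bool" where
  "kTRDS G k S \<longleftrightarrow> kTDS G k S \<and>
     (\<forall>x\<in>verts G - S. k \<le> card (neighborhood G x \<inter> (verts G - S)))"

text \<open>
  The two numbers below are minima only if suitable sets exist (otherwise they are 0 by
  the convention on the empty infimum). For \<open>k\<close> at most the minimum degree of a graph
  they do exist and the infima are attained, as shown in \<open>gamma_kt_attained\<close> and
  \<open>gamma_ktr_attained\<close>.
\<close>

definition gamma_kt :: "('a, 'b) pre_digraph \<Rightarrow> nat \<Rightarrow> nat" where
  "gamma_kt G k = (INF S\<in>{S. kTDS G k S}. card S)"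

definition gamma_ktr :: "('a, 'b) pre_digraph \<Rightarrow> nat \<Rightarrow> nat" where
  "gamma_ktr G k = (INF S\<in>{S. kTRDS G k S}. card S)"

lemma (in graph) neighborhood_subset: "neighborhood G x \<subseteq> verts G"
  by (auto simp: neighborhood_def arcs_ends_conv)

lemma (in graph) card_neighborhood: "card (neighborhood G x) = out_degree G x"
proof -
  have "neighborhood G x = head G ` out_arcs G x"
    by (auto simp: neighborhood_def arcs_ends_conv)
  moreover have "inj_on (head G) (out_arcs G x)"
    by (auto intro!: inj_onI no_multi_arcs simp: arc_to_ends_def)
  ultimately show ?thesis
    by (simp add: card_image out_degree_def)
qed

lemma (in graph) kTRDS_verts:
  assumes "k \<le> min_degree G"
  shows "kTRDS G k (verts G)"
proof -
  have "k \<le> card (neighborhood G x)" if "x \<in> verts G" for x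
    using assms cINF_lower[of "\<lambda>x. card (neighborhood G x)" "verts G" x] that
    by (auto simp: min_degree_def)
  then show ?thesis
    using neighborhood_subset by (auto simp: kTRDS_def kTDS_def Int_absorb2)
qed

lemma (in graph) gamma_ktr_attained:
  assumes "k \<le> min_degree G"
  shows "\<exists>S. kTRDS G k S \<and> card S = gamma_ktr G k"
  using Inf_nat_def1[of "card ` {S. kTRDS G k S}"] kTRDS_verts[OF assms]
  by (force simp: gamma_ktr_def)

lemma (in graph) gamma_kt_attained:
  assumes "k \<le> min_degree G"
  shows "\<exists>S. kTDS G k S \<and> card S = gamma_kt G k"
  using Inf_nat_def1[of "card ` {S. kTDS G k S}"] kTRDS_verts[OF assms]
  by (force simp: gamma_kt_def kTRDS_def)

end

theory Submission
  imports Defs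
begin

text \<open>A minimum \<open>kTDS\<close> S has at most a vertices, while every vertex has at least
  a + k neighbors. So S is too small to absorb a neighborhood: each vertex keeps at least k
  neighbors outside S, and S is already restrained (\<open>kTDS_imp_kTRDS\<close>). The same S
  therefore bounds \<open>gamma_ktr\<close>.\<close>

lemma (in graph) min_degree_le:
  assumes "x \<in> verts G"
  shows "min_degree G \<le> card (neighborhood G x)"
  using cINF_lower[of "\<lambda>x. card (neighborhood G x)" "verts G" x] assms
  by (auto simp: min_degree_def)

text \<open>Deleting S from a neighborhood of size at least \<open>card S + k\<close> costs at most
  \<open>card S\<close> vertices.\<close>

lemma (in graph) kTDS_imp_kTRDS:
  assumes "kTDS G k S" and "card S + k \<le> min_degree G"
  shows "kTRDS G k S"
  unfolding kTRDS_def
proof (intro conjI ballI)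
  show "kTDS G k S" by fact
next
  fix x assume "x \<in> verts G - S"
  then have "card S + k \<le> card (neighborhood G x)"
    using assms(2) min_degree_le[of x] by simp
  moreover have "finite S"
    using assms(1) finite_subset[OF _ finite_verts] by (auto simp: kTDS_def)
  then have "card (neighborhood G x) - card S \<le> card (neighborhood G x - S)"
    by (rule diff_card_le_card_Diff)
  moreover have "neighborhood G x \<inter> (verts G - S) = neighborhood G x - S"
    using neighborhood_subset by blast
  ultimately show "k \<le> card (neighborhood G x \<inter> (verts G - S))"
    by simp
qed

lemma gamma_ktr_le:
  assumes "kTRDS G k S"
  shows "gamma_ktr G k \<le> card S"
  unfolding gamma_ktr_def using assms by (intro cINF_lower) auto

theorem theorem3p5:
  fixes G :: "('a, 'b) pre_digraph" and k :: nat and a :: real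
  assumes "graph G"
    and "k \<ge> 1"
    and "min_degree G \<ge> k"
    and "real (min_degree G) \<ge> a + real k"
    and "real (gamma_kt G k) \<le> a"
  shows "real (gamma_ktr G k) \<le> a"
proof -
  interpret graph G by fact
  \<comment> \<open>As k is at most the minimum degree, \<open>gamma_kt\<close> is a true minimum,
    not the default 0 of an empty infimum.\<close>
  obtain S where S: "kTDS G k S" "card S = gamma_kt G k"
    using gamma_kt_attained[OF assms(3)] by blast
  \<comment> \<open>The real number a only mediates between two naturals: \<open>card S\<close>
    \<le> a \<le> \<open>min_degree G\<close> - k.\<close>
  have "card S + k \<le> min_degree G"
    using S(2) assms(4,5) by linarith
  then have "gamma_ktr G k \<le> card S"
    using S(1) by (intro gamma_ktr_le kTDS_imp_kTRDS)
  then show ?thesis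
    using S(2) assms(5) by linarith
qed

end
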